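(* Let $K$ be an infinite field, $n\ge 2$, and let $p(x_1,\dots,x_m)\in K\langle x_1,\dots,x_m\rangle$ be a multilinear polynomial which, evaluated on $M_n(K)$, is neither a polynomial identity nor a central polynomial. Then $\operatorname{Im} p$ contains a matrix of the form $c_n e_{n,1}+\sum_{i=1}^{n-1}c_i e_{i,i+1}$ with $c_1,\dots,c_n\neq 0$. Consequently, when $\operatorname{char}K$ is $0$ or prime to $n$, $\operatorname{Im} p$ contains a matrix whose eigenvalues (in an algebraic closure of $K$) are $c,c\varepsilon,\dots,c\varepsilon^{n-1}$ for some $c\neq 0$, where $\varepsilon$ is a primitive $n$-th root of $1$.
   Context: $K\langle x_1,\dots,x_m\rangle$ is the free associative algebra (noncommutative polynomials). A polynomial is multilinear if it has the form $\sum_{\sigma\in S_m}c_\sigma x_{\sigma(1)}\cdots x_{\sigma(m)}$ with $c_\sigma\in K$. For an algebra $R$, $\operatorname{Im} p=\{p(a_1,\dots,a_m): a_i\in R\}$. $p$ is a polynomial identity (PI) of $R$ if $\operatorname{Im} p=\{0\}$, and a central polynomial if $\operatorname{Im} p$ is contained in the center of $R$ (the scalar matrices for $R=M_n(K)$) but $p$ is not a PI. $e_{i,j}$ denote the matrix units. *)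

theory Defs
  imports "Jordan_Normal_Form.Char_Poly" "HOL-Algebra.Algebraic_Closure_Type"
    "HOL-Combinatorics.Permutations"
begin

text \<open>A multilinear polynomial in the noncommuting variables x_0, ..., x_(m-1) over K is
  sum over sigma in S_m of c sigma * x_(sigma 0) ... x_(sigma (m-1));
  it is given by its coefficient function c on permutations of the index set.\<close>

definition mat_prod_list :: "nat \<Rightarrow> 'a::comm_ring_1 mat list \<Rightarrow> 'a mat" where
  "mat_prod_list n xs = foldr (*) xs (1\<^sub>m n)"

definition eval_multilin ::
  "nat \<Rightarrow> nat \<Rightarrow> ((nat \<Rightarrow> nat) \<Rightarrow> 'a::field) \<Rightarrow> (nat \<Rightarrow> 'a mat) \<Rightarrow> 'a mat" where
  "eval_multilin n m c a =
     mat n n (\<lambda>ij. \<Sum>\<sigma> \<in> {\<sigma>. \<sigma> permutes {..<m}}.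
        c \<sigma> * mat_prod_list n (map (\<lambda>i. a (\<sigma> i)) [0..<m]) $$ ij)"

definition image_multilin :: "nat \<Rightarrow> nat \<Rightarrow> ((nat \<Rightarrow> nat) \<Rightarrow> 'a::field) \<Rightarrow> 'a mat set" where
  "image_multilin n m c =
     {eval_multilin n m c a | a. \<forall>i<m. a i \<in> carrier_mat n n}"

definition is_PI :: "nat \<Rightarrow> nat \<Rightarrow> ((nat \<Rightarrow> nat) \<Rightarrow> 'a::field) \<Rightarrow> bool" where
  "is_PI n m c \<longleftrightarrow> image_multilin n m c = {0\<^sub>m n n}"

definition is_central :: "nat \<Rightarrow> nat \<Rightarrow> ((nat \<Rightarrow> nat) \<Rightarrow> 'a::field) \<Rightarrow> bool" where
  "is_central n m c \<longleftrightarrow>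
     image_multilin n m c \<subseteq> {k \<cdot>\<^sub>m 1\<^sub>m n | k. True} \<and> \<not> is_PI n m c"

text \<open>The matrix c_n e_(n,1) + sum_(i=1)^(n-1) c_i e_(i,i+1), written with 0-based indices:
  entry (i, i+1) is cs i for i < n-1, entry (n-1, 0) is cs (n-1).\<close>
definition cyclic_mat :: "nat \<Rightarrow> (nat \<Rightarrow> 'a::zero) \<Rightarrow> 'a mat" where
  "cyclic_mat n cs = mat n n (\<lambda>(i, j).
     if j = i + 1 then cs i else if i = n - 1 \<and> j = 0 then cs (n - 1) else 0)"

definition primitive_root :: "nat \<Rightarrow> 'b::comm_ring_1 \<Rightarrow> bool" where
  "primitive_root n \<epsilon> \<longleftrightarrow> \<epsilon> ^ n = 1 \<and> (\<forall>k. 0 < k \<and> k < n \<longrightarrow> \<epsilon> ^ k \<noteq> 1)"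

end

theory Submission
  imports Defs "HOL-Number_Theory.Cong" "Jordan_Normal_Form.Column_Operations"
begin

text \<open>
  A value of p that is not scalar has a conjugate with nonzero (0,1) entry. Decomposing the
  arguments slot by slot into components that are homogeneous for the grading of the matrix algebra
  in which e_(i,j) has degree j - i modulo n, some homogeneous arguments already give a nonzero
  (0,1) entry; their degrees then sum to 1, so p maps all arguments of these degrees to matrices
  of cyclic shape. Conjugating with cyclic shifts preserves the degrees and shows that each of the
  n cyclic entries is not identically zero on them. Each of these entries is polynomial along
  the line joining two argument tuples, so over an infinite field they are simultaneously nonzero
  somewhere. The characteristic polynomial of a cyclic matrix is X^n - c_1 ... c_n.
\<close>

section \<open>Products and evaluations, entry by entry\<close>

lemma index_mult_mat_sum:
  assumes "A \<in> carrier_mat n n" "B \<in> carrier_mat n n" "i < n" "j < n"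
  shows "(A * B) $$ (i, j) = (\<Sum>p<n. A $$ (i, p) * B $$ (p, j))"
  using assms by (auto simp: scalar_prod_def atLeast0LessThan intro!: sum.cong)

lemma mat_prod_list_Nil [simp]: "mat_prod_list n [] = 1\<^sub>m n"
  and mat_prod_list_Cons [simp]: "mat_prod_list n (A # As) = A * mat_prod_list n As"
  by (simp_all add: mat_prod_list_def)

lemma mat_prod_list_carrier:
  assumes "\<And>A. A \<in> set As \<Longrightarrow> A \<in> carrier_mat n n"
  shows "mat_prod_list n As \<in> carrier_mat n n"
  using assms by (induction As) (simp_all add: mult_carrier_mat[of _ n n])

lemma set_map_permutes:
  assumes "\<sigma> permutes {..<m}"
  shows "set (map \<sigma> [0..<m]) = {..<m}"
  using permutes_image[OF assms] by (simp add: atLeast0LessThan)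

lemma permutes_lessThan_iff: "\<sigma> permutes {..<m} \<Longrightarrow> \<sigma> i < m \<longleftrightarrow> i < m"
  using permutes_in_image[of \<sigma> "{..<m}" i] by simp

lemma distinct_map_permutes:
  assumes "\<sigma> permutes {..<m}"
  shows "distinct (map \<sigma> [0..<m])"
  using permutes_inj_on[OF assms] by (simp add: distinct_map atLeast0LessThan)

lemma eval_multilin_carrier [simp]: "eval_multilin n m c a \<in> carrier_mat n n"
  by (simp add: eval_multilin_def)

text \<open>The factors appear as \<open>a\<close> mapped over the index list of
  \<open>\<sigma>\<close>. Facts proved by induction on an arbitrary list \<open>ks\<close> of
  indices then apply to every monomial.\<close>

lemma eval_multilin_index:
  assumes "i < n" "j < n"
  shows "eval_multilin n m c a $$ (i, j) =
    (\<Sum>\<sigma> \<in> {\<sigma>. \<sigma> permutes {..<m}}. c \<sigma> * mat_prod_list n (map a (map \<sigma> [0..<m])) $$ (i, j))"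
  using assms by (simp add: eval_multilin_def comp_def)

lemma eval_multilin_cong:
  assumes "\<And>k. k < m \<Longrightarrow> a k = b k"
  shows "eval_multilin n m c a = eval_multilin n m c b"
proof -
  have "map (\<lambda>i. a (\<sigma> i)) [0..<m] = map (\<lambda>i. b (\<sigma> i)) [0..<m]" if "\<sigma> permutes {..<m}" for \<sigma>
    using assms that by (auto simp: permutes_lessThan_iff)
  then show ?thesis
    unfolding eval_multilin_def by (intro cong_mat refl sum.cong) (simp only: mem_Collect_eq)
qed

lemma image_multilinI:
  "(\<And>i. i < m \<Longrightarrow> a i \<in> carrier_mat n n) \<Longrightarrow> eval_multilin n m c a \<in> image_multilin n m c"
  by (auto simp: image_multilin_def)

subsection \<open>Multilinearity and conjugation\<close>

text \<open>Distinctness makes the slot \<open>k\<close> occur exactly once: if it is the head, the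
  update leaves the tail alone; otherwise the sum is pulled out of the tail. The decomposition of
  \<open>a k\<close> is entrywise because the size of a matrix is not part of its type.\<close>

lemma mat_prod_list_slot_sum:
  fixes a :: "nat \<Rightarrow> 'a::comm_ring_1 mat"
  assumes "distinct ks" "k \<in> set ks" "finite G"
    and "\<And>l. l \<in> set ks \<Longrightarrow> a l \<in> carrier_mat n n"
    and "\<And>g. g \<in> G \<Longrightarrow> B g \<in> carrier_mat n n"
    and "\<And>i j. i < n \<Longrightarrow> j < n \<Longrightarrow> a k $$ (i, j) = (\<Sum>g\<in>G. B g $$ (i, j))"
    and "i < n" "j < n"
  shows "mat_prod_list n (map a ks) $$ (i, j) =
    (\<Sum>g\<in>G. mat_prod_list n (map (a(k := B g)) ks) $$ (i, j))"
  using assms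
proof (induction ks arbitrary: i)
  case (Cons l ks)
  have car: "mat_prod_list n (map a ks) \<in> carrier_mat n n"
    using Cons.prems(4) by (intro mat_prod_list_carrier) auto
  have car': "mat_prod_list n (map (a(k := B g)) ks) \<in> carrier_mat n n" if "g \<in> G" for g
    using Cons.prems(4,5) that by (intro mat_prod_list_carrier) auto
  show ?case
  proof (cases "l = k")
    case True
    have tail: "map (a(k := B g)) ks = map a ks" for g
      using Cons.prems(1) True by auto
    have "mat_prod_list n (map a (l # ks)) $$ (i, j)
        = (\<Sum>p<n. (\<Sum>g\<in>G. B g $$ (i, p)) * mat_prod_list n (map a ks) $$ (p, j))"
      using Cons.prems True car by (simp add: index_mult_mat_sum[of _ n] del: index_mult_mat)
    also have "\<dots> = (\<Sum>g\<in>G. \<Sum>p<n. B g $$ (i, p) * mat_prod_list n (map a ks) $$ (p, j))"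
      unfolding sum_distrib_right by (rule sum.swap)
    also have "\<dots> = (\<Sum>g\<in>G. mat_prod_list n (map (a(k := B g)) (l # ks)) $$ (i, j))"
      using Cons.prems True car
      by (intro sum.cong refl) (simp add: index_mult_mat_sum[of _ n] tail del: index_mult_mat)
    finally show ?thesis .
  next
    case False
    have IH: "mat_prod_list n (map a ks) $$ (p, j)
        = (\<Sum>g\<in>G. mat_prod_list n (map (a(k := B g)) ks) $$ (p, j))" if "p < n" for p
      using Cons.prems False that by (intro Cons.IH) auto
    have "mat_prod_list n (map a (l # ks)) $$ (i, j)
        = (\<Sum>p<n. a l $$ (i, p) * (\<Sum>g\<in>G. mat_prod_list n (map (a(k := B g)) ks) $$ (p, j)))"
      using Cons.prems car by (simp add: index_mult_mat_sum[of _ n] IH del: index_mult_mat)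
    also have "\<dots> = (\<Sum>g\<in>G. \<Sum>p<n. a l $$ (i, p) * mat_prod_list n (map (a(k := B g)) ks) $$ (p, j))"
      unfolding sum_distrib_left by (rule sum.swap)
    also have "\<dots> = (\<Sum>g\<in>G. mat_prod_list n (map (a(k := B g)) (l # ks)) $$ (i, j))"
      using Cons.prems False car'
      by (intro sum.cong refl) (simp add: index_mult_mat_sum[of _ n] del: index_mult_mat)
    finally show ?thesis .
  qed
qed simp

text \<open>Each permutation lists every slot once, so every monomial is additive in slot
  \<open>k\<close>; the two sums are then interchanged.\<close>

lemma eval_multilin_slot_sum:
  assumes "k < m" "finite G"
    and "\<And>l. l < m \<Longrightarrow> a l \<in> carrier_mat n n"
    and "\<And>g. g \<in> G \<Longrightarrow> B g \<in> carrier_mat n n"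
    and "\<And>i j. i < n \<Longrightarrow> j < n \<Longrightarrow> a k $$ (i, j) = (\<Sum>g\<in>G. B g $$ (i, j))"
    and "i < n" "j < n"
  shows "eval_multilin n m c a $$ (i, j) = (\<Sum>g\<in>G. eval_multilin n m c (a(k := B g)) $$ (i, j))"
proof -
  have "mat_prod_list n (map a (map \<sigma> [0..<m])) $$ (i, j) =
    (\<Sum>g\<in>G. mat_prod_list n (map (a(k := B g)) (map \<sigma> [0..<m])) $$ (i, j))"
    if "\<sigma> permutes {..<m}" for \<sigma>
    using assms by (intro mat_prod_list_slot_sum distinct_map_permutes[OF that])
      (simp_all only: set_map_permutes[OF that] lessThan_iff)
  then have "eval_multilin n m c a $$ (i, j) = (\<Sum>\<sigma> \<in> {\<sigma>. \<sigma> permutes {..<m}}.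
      \<Sum>g\<in>G. c \<sigma> * mat_prod_list n (map (a(k := B g)) (map \<sigma> [0..<m])) $$ (i, j))"
    unfolding eval_multilin_index[OF assms(6,7)]
    by (intro sum.cong refl) (simp only: mem_Collect_eq sum_distrib_left)
  also have "\<dots> = (\<Sum>g\<in>G. eval_multilin n m c (a(k := B g)) $$ (i, j))"
    unfolding eval_multilin_index[OF assms(6,7)] by (rule sum.swap)
  finally show ?thesis .
qed

text \<open>Between neighbouring factors \<open>Q * P\<close> cancels, so the product telescopes;
  the empty product uses \<open>P * Q = 1\<^sub>m n\<close>.\<close>

lemma mat_prod_list_conj:
  fixes a :: "nat \<Rightarrow> 'a::comm_ring_1 mat"
  assumes P: "P \<in> carrier_mat n n" and Q: "Q \<in> carrier_mat n n"
    and PQ: "P * Q = 1\<^sub>m n" and QP: "Q * P = 1\<^sub>m n"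
    and "\<And>k. k \<in> set ks \<Longrightarrow> a k \<in> carrier_mat n n"
  shows "mat_prod_list n (map (\<lambda>k. P * a k * Q) ks) = P * mat_prod_list n (map a ks) * Q"
  using assms(5)
proof (induction ks)
  case Nil
  then show ?case using P PQ by simp
next
  case (Cons k ks)
  define M where "M = mat_prod_list n (map a ks)"
  have M: "M \<in> carrier_mat n n"
    unfolding M_def using Cons.prems by (intro mat_prod_list_carrier) auto
  have A: "a k \<in> carrier_mat n n" using Cons.prems by simp
  have "(P * a k * Q) * (P * M * Q) = P * a k * (Q * P) * M * Q"
    using P Q A M by (simp add: assoc_mult_mat[of _ n n _ n _ n])
  also have "\<dots> = P * (a k * M) * Q"
    using P Q A M by (simp add: QP assoc_mult_mat[of _ n n _ n _ n])
  finally show ?case using Cons by (simp add: M_def)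
qed

lemma index_conj_mat:
  fixes A :: "'a::comm_ring_1 mat"
  assumes "P \<in> carrier_mat n n" "Q \<in> carrier_mat n n" "A \<in> carrier_mat n n" "i < n" "j < n"
  shows "(P * A * Q) $$ (i, j) = (\<Sum>q<n. \<Sum>p<n. P $$ (i, p) * A $$ (p, q) * Q $$ (q, j))"
  using assms by (simp add: index_mult_mat_sum[of "P * A" n] index_mult_mat_sum[of P n]
      sum_distrib_right del: index_mult_mat assoc_mult_mat)

text \<open>Conjugation respects products and linear combinations, hence commutes with evaluating
  any polynomial. Linearity is carried out on entries, by moving the sum over permutations
  inside.\<close>

lemma eval_multilin_conj:
  assumes P: "P \<in> carrier_mat n n" and Q: "Q \<in> carrier_mat n n"
    and "P * Q = 1\<^sub>m n" and "Q * P = 1\<^sub>m n"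
    and a: "\<And>k. k < m \<Longrightarrow> a k \<in> carrier_mat n n"
  shows "eval_multilin n m c (\<lambda>k. P * a k * Q) = P * eval_multilin n m c a * Q"
proof (rule eq_matI)
  fix i j assume "i < dim_row (P * eval_multilin n m c a * Q)" "j < dim_col (P * eval_multilin n m c a * Q)"
  then have ij: "i < n" "j < n" using P Q by auto
  let ?S = "{\<sigma>. \<sigma> permutes {..<m}}"
  let ?M = "\<lambda>\<sigma>. mat_prod_list n (map a (map \<sigma> [0..<m]))"
  have M: "?M \<sigma> \<in> carrier_mat n n" if "\<sigma> \<in> ?S" for \<sigma>
    using a set_map_permutes[of \<sigma> m] that by (intro mat_prod_list_carrier) (auto simp: permutes_lessThan_iff)
  have "eval_multilin n m c (\<lambda>k. P * a k * Q) $$ (i, j) = (\<Sum>\<sigma>\<in>?S. c \<sigma> * (P * ?M \<sigma> * Q) $$ (i, j))"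
    unfolding eval_multilin_index[OF ij]
    using a set_map_permutes[of _ m] assms(1-4)
    by (intro sum.cong refl arg_cong2[of _ _ _ _ "(*)"] arg_cong[of _ _ "\<lambda>M. M $$ (i, j)"]
          mat_prod_list_conj) (auto simp: permutes_lessThan_iff)
  also have "\<dots> = (\<Sum>\<sigma>\<in>?S. \<Sum>q<n. \<Sum>p<n. P $$ (i, p) * (c \<sigma> * ?M \<sigma> $$ (p, q)) * Q $$ (q, j))"
    using M ij P Q
    by (intro sum.cong refl, subst index_conj_mat) (auto simp: sum_distrib_left mult_ac)
  also have "\<dots> = (\<Sum>q<n. \<Sum>p<n. \<Sum>\<sigma>\<in>?S. P $$ (i, p) * (c \<sigma> * ?M \<sigma> $$ (p, q)) * Q $$ (q, j))"
    by (subst sum.swap, intro sum.cong refl, rule sum.swap)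
  also have "\<dots> = (P * eval_multilin n m c a * Q) $$ (i, j)"
    using ij P Q
    by (subst index_conj_mat)
      (auto simp: eval_multilin_index sum_distrib_left sum_distrib_right simp del: map_map intro!: sum.cong)
  finally show "eval_multilin n m c (\<lambda>k. P * a k * Q) $$ (i, j)
      = (P * eval_multilin n m c a * Q) $$ (i, j)" .
qed (use P Q in \<open>auto simp: eval_multilin_def\<close>)

section \<open>Similarity of values and a nonzero off-diagonal entry\<close>

lemma image_multilin_conj:
  assumes "P \<in> carrier_mat n n" "Q \<in> carrier_mat n n" "P * Q = 1\<^sub>m n" "Q * P = 1\<^sub>m n"
    and "A \<in> image_multilin n m c"
  shows "P * A * Q \<in> image_multilin n m c"
proof -
  obtain a where a: "A = eval_multilin n m c a" "\<And>k. k < m \<Longrightarrow> a k \<in> carrier_mat n n"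
    using assms(5) by (auto simp: image_multilin_def)
  have "P * A * Q = eval_multilin n m c (\<lambda>k. P * a k * Q)"
    unfolding a(1) using assms(1-4) a(2) by (intro eval_multilin_conj[symmetric])
  then show ?thesis using assms(1,2) a(2) by (auto intro!: image_multilinI)
qed

text \<open>\<open>P\<close> is the permutation matrix of \<open>\<pi>\<close> and \<open>Q\<close>
  its transpose, so conjugation relabels rows and columns simultaneously. This serves both to move a
  chosen entry to position (0,1) and to shift indices cyclically.\<close>

lemma permutation_conjugator:
  fixes \<pi> :: "nat \<Rightarrow> nat"
  assumes "inj_on \<pi> {..<n}" "\<pi> ` {..<n} \<subseteq> {..<n}"
  obtains P Q :: "'a::field mat" where "P \<in> carrier_mat n n" "Q \<in> carrier_mat n n"
    "P * Q = 1\<^sub>m n" "Q * P = 1\<^sub>m n"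
    "\<And>A i j. A \<in> carrier_mat n n \<Longrightarrow> i < n \<Longrightarrow> j < n \<Longrightarrow> (P * A * Q) $$ (i, j) = A $$ (\<pi> i, \<pi> j)"
proof -
  define P :: "'a mat" where "P = mat n n (\<lambda>(i, p). if p = \<pi> i then 1 else 0)"
  define Q :: "'a mat" where "Q = mat n n (\<lambda>(q, j). if q = \<pi> j then 1 else 0)"
  have car: "P \<in> carrier_mat n n" "Q \<in> carrier_mat n n" by (auto simp: P_def Q_def)
  have \<pi>: "\<pi> i < n" if "i < n" for i using assms(2) that by auto
  have PQ: "P * Q = 1\<^sub>m n"
  proof (rule eq_matI)
    fix i j assume "i < dim_row (1\<^sub>m n :: 'a mat)" "j < dim_col (1\<^sub>m n :: 'a mat)"
    then have ij: "i < n" "j < n" by auto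
    have "(P * Q) $$ (i, j) = (\<Sum>p<n. if p = \<pi> i then (if p = \<pi> j then 1 else 0) else 0)"
      unfolding index_mult_mat_sum[OF car ij] using ij
      by (intro sum.cong refl) (auto simp: P_def Q_def)
    also have "\<dots> = (if \<pi> i = \<pi> j then 1 else 0)" using \<pi>[OF ij(1)] by simp
    also have "\<dots> = 1\<^sub>m n $$ (i, j)" using ij assms(1) by (auto simp: inj_on_def)
    finally show "(P * Q) $$ (i, j) = 1\<^sub>m n $$ (i, j)" .
  qed (use car in auto)
  have "(P * A * Q) $$ (i, j) = A $$ (\<pi> i, \<pi> j)"
    if "A \<in> carrier_mat n n" "i < n" "j < n" for A i j
  proof -
    have "(\<Sum>p<n. P $$ (i, p) * A $$ (p, q) * Q $$ (q, j)) = (if q = \<pi> j then A $$ (\<pi> i, q) else 0)"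
      if "q < n" for q
    proof -
      have "(\<Sum>p<n. P $$ (i, p) * A $$ (p, q) * Q $$ (q, j))
          = (\<Sum>p<n. if p = \<pi> i then A $$ (p, q) * Q $$ (q, j) else 0)"
        using \<open>i < n\<close> by (intro sum.cong refl) (simp add: P_def)
      also have "\<dots> = A $$ (\<pi> i, q) * Q $$ (q, j)" using \<pi>[OF \<open>i < n\<close>] by simp
      finally show ?thesis using \<open>j < n\<close> \<open>q < n\<close> by (simp add: Q_def)
    qed
    then show ?thesis unfolding index_conj_mat[OF car that] using \<pi>[OF \<open>j < n\<close>] by simp
  qed
  then show ?thesis using that car PQ mat_mult_left_right_inverse[OF car PQ] by blast
qed

text \<open>A non-scalar matrix either has a nonzero off-diagonal entry or is diagonal with two
  different diagonal entries. The second case is reduced to the first by an elementary conjugation,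
  and a permutation then brings the entry to (0,1).\<close>

lemma image_multilin_nonscalar_entry:
  assumes n: "n \<ge> 2" and A: "A \<in> image_multilin n m c"
    and nonscalar: "\<not> (\<exists>k. A = k \<cdot>\<^sub>m 1\<^sub>m n)"
  shows "\<exists>B \<in> image_multilin n m c. B $$ (0, 1) \<noteq> 0"
proof -
  have carA: "A \<in> carrier_mat n n" using A by (auto simp: image_multilin_def)
  have "\<exists>B \<in> image_multilin n m c. \<exists>i j. i < n \<and> j < n \<and> i \<noteq> j \<and> B $$ (i, j) \<noteq> 0"
  proof (cases "\<exists>i j. i < n \<and> j < n \<and> i \<noteq> j \<and> A $$ (i, j) \<noteq> 0")
    case True
    then show ?thesis using A by blast
  next
    case False
    have "\<exists>i<n. A $$ (i, i) \<noteq> A $$ (0, 0)"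
    proof (rule ccontr)
      assume "\<not> ?thesis"
      then have diag: "A $$ (i, i) = A $$ (0, 0)" if "i < n" for i using that by blast
      have "A = A $$ (0, 0) \<cdot>\<^sub>m 1\<^sub>m n"
      proof (rule eq_matI)
        fix i j assume "i < dim_row (A $$ (0, 0) \<cdot>\<^sub>m 1\<^sub>m n)" "j < dim_col (A $$ (0, 0) \<cdot>\<^sub>m 1\<^sub>m n)"
        then have ij: "i < n" "j < n" by auto
        then show "A $$ (i, j) = (A $$ (0, 0) \<cdot>\<^sub>m 1\<^sub>m n) $$ (i, j)"
          using False diag[OF ij(1)] by (cases "i = j") auto
      qed (use carA in auto)
      with nonscalar show False by blast
    qed
    then obtain i where i: "i < n" "A $$ (i, i) \<noteq> A $$ (0, 0)" by blast
    then have i0: "i \<noteq> 0" by metis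
    \<comment> \<open>These are 1 + e_(i,0) and its inverse 1 - e_(i,0). For diagonal
      \<open>A\<close> this conjugation places the difference of the diagonal entries 0 and
      \<open>i\<close> at position (i,0).\<close>
    define P Q :: "'a mat" where "P = addrow_mat n 1 i 0" and "Q = addrow_mat n (-1) i 0"
    have car: "P \<in> carrier_mat n n" "Q \<in> carrier_mat n n" by (auto simp: P_def Q_def)
    have PQ: "P * Q = 1\<^sub>m n" unfolding P_def Q_def using n i i0 by (intro addrow_mat_inv) auto
    have PA: "P * A = addrow 1 i 0 A" unfolding P_def using n carA
      by (intro addrow_mat[symmetric]) auto
    have "P * A * Q = addcol (-1) 0 i (P * A)" unfolding Q_def
      using carA car i by (intro addcol_mat[symmetric]) auto
    moreover have "A $$ (i, 0) = 0" "A $$ (0, i) = 0" using False i i0 n by auto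
    ultimately have "(P * A * Q) $$ (i, 0) = A $$ (0, 0) - A $$ (i, i)"
      unfolding PA using carA i i0 n by auto
    then have "(P * A * Q) $$ (i, 0) \<noteq> 0" using i by simp
    moreover have "P * A * Q \<in> image_multilin n m c"
      using car PQ mat_mult_left_right_inverse[OF car PQ] A by (intro image_multilin_conj)
    ultimately show ?thesis using i i0 n by (metis less_le_trans zero_less_numeral)
  qed
  then obtain B i j where B: "B \<in> image_multilin n m c" "i < n" "j < n" "i \<noteq> j" "B $$ (i, j) \<noteq> 0"
    by blast
  \<comment> \<open>The permutation must send 0 to \<open>i\<close> and 1 to \<open>j\<close>. The
    outer swap settles 0; the inner swap of 1 with \<open>\<tau> j\<close> settles 1 and fixes 0,
    because \<open>\<tau> j\<close> is not 0.\<close>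
  define \<tau> where "\<tau> = Transposition.transpose 0 i"
  define \<pi> where "\<pi> = \<tau> \<circ> Transposition.transpose 1 (\<tau> j)"
  have \<tau>j: "\<tau> j \<noteq> 0" "\<tau> j < n" using B n by (auto simp: \<tau>_def Transposition.transpose_def)
  have perm: "\<pi> permutes {..<n}"
    unfolding \<pi>_def \<tau>_def using n B \<tau>j[unfolded \<tau>_def]
    by (intro permutes_compose permutes_swap_id) auto
  have \<pi>01: "\<pi> 0 = i" "\<pi> 1 = j"
    using \<tau>j by (auto simp: \<pi>_def \<tau>_def transpose_apply_other)
  obtain P Q :: "'a mat" where PQ: "P \<in> carrier_mat n n" "Q \<in> carrier_mat n n"
    "P * Q = 1\<^sub>m n" "Q * P = 1\<^sub>m n"
    and conj: "\<And>A i j. A \<in> carrier_mat n n \<Longrightarrow> i < n \<Longrightarrow> j < n \<Longrightarrow> (P * A * Q) $$ (i, j) = A $$ (\<pi> i, \<pi> j)"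
    using permutation_conjugator[of \<pi> n] permutes_inj_on[OF perm] permutes_image[OF perm] by blast
  have "B \<in> carrier_mat n n" using B(1) by (auto simp: image_multilin_def)
  then have "(P * B * Q) $$ (0, 1) = B $$ (i, j)"
    using conj[of B 0 1] n \<pi>01 by simp
  then show ?thesis using image_multilin_conj[OF PQ B(1)] B(5) by metis
qed

subsection \<open>The grading by residues modulo n\<close>

text \<open>Here e_(i,j) has degree j - i modulo n. The degree \<open>g\<close> is any natural
  number and only its residue matters, so degrees add without reduction; the zero matrix has every
  degree.\<close>

definition homogeneous_mat :: "nat \<Rightarrow> nat \<Rightarrow> 'a::zero mat \<Rightarrow> bool" where
  "homogeneous_mat n g A \<longleftrightarrow> A \<in> carrier_mat n n \<and>
     (\<forall>i<n. \<forall>j<n. A $$ (i, j) \<noteq> 0 \<longrightarrow> j = (i + g) mod n)"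

definition homogeneous_part :: "nat \<Rightarrow> nat \<Rightarrow> 'a::zero mat \<Rightarrow> 'a mat" where
  "homogeneous_part n g A = mat n n (\<lambda>(i, j). if j = (i + g) mod n then A $$ (i, j) else 0)"

lemma homogeneous_part: "homogeneous_mat n g (homogeneous_part n g A)"
  by (auto simp: homogeneous_mat_def homogeneous_part_def)

lemma homogeneous_mat_carrier: "homogeneous_mat n g A \<Longrightarrow> A \<in> carrier_mat n n"
  by (simp add: homogeneous_mat_def)

lemma homogeneous_matD:
  "homogeneous_mat n g A \<Longrightarrow> i < n \<Longrightarrow> j < n \<Longrightarrow> A $$ (i, j) \<noteq> 0 \<Longrightarrow> j = (i + g) mod n"
  by (simp add: homogeneous_mat_def)

text \<open>Every position (i,j) belongs to exactly one residue \<open>g\<close>, namely j - i,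
  increased by n when i exceeds j.\<close>

lemma sum_homogeneous_parts:
  assumes "i < n" "j < n"
  shows "(A :: 'a::comm_monoid_add mat) $$ (i, j) = (\<Sum>g<n. homogeneous_part n g A $$ (i, j))"
proof -
  have "j = (i + g) mod n \<longleftrightarrow> g = (if i \<le> j then j - i else n + j - i)" if "g < n" for g
    using assms that by (auto simp: mod_if)
  then have "(\<Sum>g<n. homogeneous_part n g A $$ (i, j))
      = (\<Sum>g<n. if g = (if i \<le> j then j - i else n + j - i) then A $$ (i, j) else 0)"
    using assms by (intro sum.cong refl) (simp add: homogeneous_part_def)
  also have "\<dots> = A $$ (i, j)" using assms by auto
  finally show ?thesis ..
qed

text \<open>A nonzero entry of a product comes from a path from \<open>i\<close> through some
  \<open>p\<close> to \<open>j\<close> with both factors nonzero, and the degrees add along the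
  path.\<close>

lemma homogeneous_mat_prod_list:
  fixes a :: "nat \<Rightarrow> 'a::comm_ring_1 mat"
  assumes "\<And>k. k \<in> set ks \<Longrightarrow> homogeneous_mat n (g k) (a k)"
  shows "homogeneous_mat n (\<Sum>k\<leftarrow>ks. g k) (mat_prod_list n (map a ks))"
  using assms
proof (induction ks)
  case Nil
  then show ?case by (auto simp: homogeneous_mat_def)
next
  case (Cons k ks)
  let ?M = "mat_prod_list n (map a ks)"
  have A: "homogeneous_mat n (g k) (a k)" and M: "homogeneous_mat n (\<Sum>k\<leftarrow>ks. g k) ?M"
    using Cons by auto
  have "j = (i + (g k + (\<Sum>k\<leftarrow>ks. g k))) mod n"
    if ij: "i < n" "j < n" and nz: "(a k * ?M) $$ (i, j) \<noteq> 0" for i j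
  proof -
    obtain p where p: "p < n" "a k $$ (i, p) * ?M $$ (p, j) \<noteq> 0"
      using nz unfolding index_mult_mat_sum[OF homogeneous_mat_carrier[OF A] homogeneous_mat_carrier[OF M] ij]
      by (metis (no_types, lifting) lessThan_iff sum.neutral)
    then have "a k $$ (i, p) \<noteq> 0" "?M $$ (p, j) \<noteq> 0" by auto
    then have "p = (i + g k) mod n" "j = (p + (\<Sum>k\<leftarrow>ks. g k)) mod n"
      using homogeneous_matD[OF A ij(1) p(1)] homogeneous_matD[OF M p(1) ij(2)] by auto
    then show ?thesis by (simp add: mod_add_left_eq add.assoc)
  qed
  then show ?case
    using homogeneous_mat_carrier[OF A] homogeneous_mat_carrier[OF M]
    by (auto simp: homogeneous_mat_def simp del: index_mult_mat(1))
qed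

text \<open>The total degree does not depend on the order of the factors, so all monomials lie in
  the same homogeneous component.\<close>

lemma homogeneous_eval_multilin:
  assumes "\<And>k. k < m \<Longrightarrow> homogeneous_mat n (g k) (a k)"
  shows "homogeneous_mat n (\<Sum>k<m. g k) (eval_multilin n m c a)"
proof -
  have hom: "homogeneous_mat n (\<Sum>k<m. g k) (mat_prod_list n (map a (map \<sigma> [0..<m])))"
    if "\<sigma> permutes {..<m}" for \<sigma>
  proof -
    have "(\<Sum>k\<leftarrow>map \<sigma> [0..<m]. g k) = (\<Sum>k<m. g k)"
      using sum_list_distinct_conv_sum_set[OF distinct_map_permutes[OF that], of g]
      unfolding set_map_permutes[OF that] .
    then show ?thesis
      using homogeneous_mat_prod_list[of "map \<sigma> [0..<m]" n g a] assms
      unfolding set_map_permutes[OF that] by simp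
  qed
  have "j = (i + (\<Sum>k<m. g k)) mod n"
    if ij: "i < n" "j < n" and nz: "eval_multilin n m c a $$ (i, j) \<noteq> 0" for i j
  proof -
    obtain \<sigma> where "\<sigma> permutes {..<m}" "mat_prod_list n (map a (map \<sigma> [0..<m])) $$ (i, j) \<noteq> 0"
      using nz unfolding eval_multilin_index[OF ij]
      by (metis (no_types, lifting) mem_Collect_eq mult_zero_right sum.neutral)
    with hom ij show ?thesis unfolding homogeneous_mat_def by blast
  qed
  then show ?thesis by (simp add: homogeneous_mat_def)
qed

lemma eval_multilin_homogeneous_arguments:
  assumes "\<And>k. k < m \<Longrightarrow> a k \<in> carrier_mat n n"
    and "i < n" "j < n" "eval_multilin n m c a $$ (i, j) \<noteq> 0"
  shows "\<exists>b g. (\<forall>k<m. homogeneous_mat n (g k) (b k)) \<and> eval_multilin n m c b $$ (i, j) \<noteq> 0"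
proof -
  \<comment> \<open>The arguments are made homogeneous one at a time; \<open>r\<close> counts the
    slots already treated. Splitting the next slot writes the nonzero entry as a sum over
    \<open>h\<close>, so some summand is nonzero.\<close>
  have "\<exists>b g. (\<forall>k<m. b k \<in> carrier_mat n n) \<and> (\<forall>k<r. homogeneous_mat n (g k) (b k))
      \<and> eval_multilin n m c b $$ (i, j) \<noteq> 0" if "r \<le> m" for r
    using that
  proof (induction r)
    case 0
    then show ?case using assms by auto
  next
    case (Suc r)
    then obtain b g where b: "\<And>k. k < m \<Longrightarrow> b k \<in> carrier_mat n n"
      "\<And>k. k < r \<Longrightarrow> homogeneous_mat n (g k) (b k)" "eval_multilin n m c b $$ (i, j) \<noteq> 0"
      by auto
    have "eval_multilin n m c b $$ (i, j)
        = (\<Sum>h<n. eval_multilin n m c (b(r := homogeneous_part n h (b r))) $$ (i, j))"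
      using Suc.prems b(1) assms(2,3)
      by (intro eval_multilin_slot_sum sum_homogeneous_parts)
        (auto intro: homogeneous_mat_carrier homogeneous_part)
    then obtain h where nz: "eval_multilin n m c (b(r := homogeneous_part n h (b r))) $$ (i, j) \<noteq> 0"
      using b(3) by (metis (no_types, lifting) sum.neutral)
    have "\<forall>k<m. (b(r := homogeneous_part n h (b r))) k \<in> carrier_mat n n"
      using b(1) homogeneous_mat_carrier[OF homogeneous_part[of n h "b r"]] by auto
    moreover have "\<forall>k<Suc r. homogeneous_mat n ((g(r := h)) k) ((b(r := homogeneous_part n h (b r))) k)"
      using b(2) homogeneous_part[of n h "b r"] by (auto simp: less_Suc_eq)
    ultimately show ?case using nz by blast
  qed
  from this[of m] show ?thesis by auto
qed

subsection \<open>Simultaneous nonvanishing\<close>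

text \<open>Polynomials in one scalar parameter suffice, since evaluations are only ever restricted
  to a line of argument tuples.\<close>

definition polynomial_fun :: "('a::comm_ring_1 \<Rightarrow> 'a) \<Rightarrow> bool" where
  "polynomial_fun f \<longleftrightarrow> (\<exists>p. \<forall>t. f t = poly p t)"

lemma polynomial_fun_const: "polynomial_fun (\<lambda>_. x)"
  unfolding polynomial_fun_def by (rule exI[of _ "[:x:]"]) simp

lemma polynomial_fun_interpolation: "polynomial_fun (\<lambda>t. (1 - t) * x + t * y)"
  unfolding polynomial_fun_def by (rule exI[of _ "[:x, y - x:]"]) (simp add: algebra_simps)

lemma polynomial_fun_mult:
  assumes "polynomial_fun f" "polynomial_fun g"
  shows "polynomial_fun (\<lambda>t. f t * g t)"
proof -
  obtain p q where "\<forall>t. f t = poly p t" "\<forall>t. g t = poly q t"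
    using assms by (auto simp: polynomial_fun_def)
  then have "\<forall>t. f t * g t = poly (p * q) t" by simp
  then show ?thesis unfolding polynomial_fun_def by blast
qed

lemma polynomial_fun_sum:
  assumes "\<And>x. x \<in> S \<Longrightarrow> polynomial_fun (f x)"
  shows "polynomial_fun (\<lambda>t. \<Sum>x\<in>S. f x t)"
proof -
  obtain p where "\<And>x t. x \<in> S \<Longrightarrow> f x t = poly (p x) t"
    using assms unfolding polynomial_fun_def by metis
  then have "\<forall>t. (\<Sum>x\<in>S. f x t) = poly (\<Sum>x\<in>S. p x) t" by (simp add: poly_sum)
  then show ?thesis unfolding polynomial_fun_def by blast
qed

lemma polynomial_fun_mat_prod_list:
  fixes A :: "'a::comm_ring_1 \<Rightarrow> nat \<Rightarrow> 'a mat"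
  assumes "\<And>k t. k \<in> set ks \<Longrightarrow> A t k \<in> carrier_mat n n"
    and "\<And>k i j. k \<in> set ks \<Longrightarrow> i < n \<Longrightarrow> j < n \<Longrightarrow> polynomial_fun (\<lambda>t. A t k $$ (i, j))"
    and "i < n" "j < n"
  shows "polynomial_fun (\<lambda>t. mat_prod_list n (map (A t) ks) $$ (i, j))"
  using assms
proof (induction ks arbitrary: i)
  case Nil
  then show ?case by (simp add: polynomial_fun_const)
next
  case (Cons k ks)
  have "mat_prod_list n (map (A t) ks) \<in> carrier_mat n n" for t
    using Cons.prems(1) by (intro mat_prod_list_carrier) auto
  then have "(\<lambda>t. mat_prod_list n (map (A t) (k # ks)) $$ (i, j))
      = (\<lambda>t. \<Sum>p<n. A t k $$ (i, p) * mat_prod_list n (map (A t) ks) $$ (p, j))"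
    using Cons.prems by (simp add: index_mult_mat_sum[of _ n] del: index_mult_mat)
  moreover have "polynomial_fun \<dots>"
    using Cons.prems by (intro polynomial_fun_sum polynomial_fun_mult Cons.IH) auto
  ultimately show ?case by simp
qed

lemma polynomial_fun_eval_multilin:
  assumes "\<And>k t. k < m \<Longrightarrow> A t k \<in> carrier_mat n n"
    and "\<And>k i j. k < m \<Longrightarrow> i < n \<Longrightarrow> j < n \<Longrightarrow> polynomial_fun (\<lambda>t. A t k $$ (i, j))"
    and "i < n" "j < n"
  shows "polynomial_fun (\<lambda>t. eval_multilin n m c (A t) $$ (i, j))"
  unfolding eval_multilin_index[OF assms(3,4)] using assms set_map_permutes[of _ m]
  by (intro polynomial_fun_sum polynomial_fun_mult polynomial_fun_const polynomial_fun_mat_prod_list)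
    (auto simp: permutes_lessThan_iff)

text \<open>Finitely many nonzero polynomials have finitely many roots altogether, and an infinite
  field contains a point outside this set.\<close>

lemma polynomial_funs_common_nonzero:
  fixes f :: "'b \<Rightarrow> 'a::field \<Rightarrow> 'a"
  assumes "infinite (UNIV :: 'a set)" "finite S"
    and "\<And>s. s \<in> S \<Longrightarrow> polynomial_fun (f s)" "\<And>s. s \<in> S \<Longrightarrow> \<exists>t. f s t \<noteq> 0"
  shows "\<exists>t. \<forall>s\<in>S. f s t \<noteq> 0"
proof -
  obtain p where p: "\<And>s t. s \<in> S \<Longrightarrow> f s t = poly (p s) t"
    using assms(3) unfolding polynomial_fun_def by metis
  have "p s \<noteq> 0" if "s \<in> S" for s using assms(4)[OF that] p[OF that] by auto
  then have "finite (\<Union>s\<in>S. {t. poly (p s) t = 0})"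
    using assms(2) poly_roots_finite by blast
  then obtain t where "t \<notin> (\<Union>s\<in>S. {t. poly (p s) t = 0})"
    using assms(1) ex_new_if_finite by blast
  then show ?thesis using p by auto
qed

text \<open>Positions are added one by one. A tuple that works for \<open>S\<close> and one that
  works for the new position are joined by a line, on which a common good point is found.\<close>

lemma eval_multilin_common_nonzero:
  fixes c :: "(nat \<Rightarrow> nat) \<Rightarrow> 'a::field"
  assumes inf: "infinite (UNIV :: 'a set)"
    and "finite S" "S \<subseteq> {..<n} \<times> {..<n}"
    and "\<And>s. s \<in> S \<Longrightarrow> \<exists>b. (\<forall>k<m. homogeneous_mat n (g k) (b k)) \<and> eval_multilin n m c b $$ s \<noteq> 0"
  shows "\<exists>b. (\<forall>k<m. homogeneous_mat n (g k) (b k)) \<and> (\<forall>s\<in>S. eval_multilin n m c b $$ s \<noteq> 0)"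
  using assms(2-4)
proof (induction S rule: finite_induct)
  case empty
  have "\<forall>k<m. homogeneous_mat n (g k) (0\<^sub>m n n :: 'a mat)" by (auto simp: homogeneous_mat_def)
  then show ?case by (intro exI[of _ "\<lambda>_. 0\<^sub>m n n"]) auto
next
  case (insert s S)
  obtain b where b: "\<And>k. k < m \<Longrightarrow> homogeneous_mat n (g k) (b k)"
    "\<And>s. s \<in> S \<Longrightarrow> eval_multilin n m c b $$ s \<noteq> 0"
    using insert.IH insert.prems by (metis insert_iff insert_subset)
  obtain b' where b': "\<And>k. k < m \<Longrightarrow> homogeneous_mat n (g k) (b' k)"
    "eval_multilin n m c b' $$ s \<noteq> 0" using insert.prems by blast
  \<comment> \<open>The line runs from \<open>b\<close> at 0 to \<open>b'\<close> at 1. It stays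
    within the prescribed degrees because matrices of one degree form a linear subspace.\<close>
  define L where "L t k = mat n n (\<lambda>ij. (1 - t) * b k $$ ij + t * b' k $$ ij)" for t k
  have homL: "homogeneous_mat n (g k) (L t k)" if "k < m" for t k
    unfolding homogeneous_mat_def
  proof (intro conjI allI impI)
    show "L t k \<in> carrier_mat n n" by (simp add: L_def)
    fix i j assume "i < n" "j < n" "L t k $$ (i, j) \<noteq> 0"
    moreover from this have "b k $$ (i, j) \<noteq> 0 \<or> b' k $$ (i, j) \<noteq> 0" by (auto simp: L_def)
    ultimately show "j = (i + g k) mod n"
      using b(1)[OF that] b'(1)[OF that] by (auto simp: homogeneous_mat_def)
  qed
  have "L 0 k = b k" if "k < m" for k
    using homogeneous_mat_carrier[OF b(1)[OF that]] by (intro eq_matI) (auto simp: L_def)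
  then have L0: "eval_multilin n m c (L 0) = eval_multilin n m c b" by (rule eval_multilin_cong)
  have "L 1 k = b' k" if "k < m" for k
    using homogeneous_mat_carrier[OF b'(1)[OF that]] by (intro eq_matI) (auto simp: L_def)
  then have L1: "eval_multilin n m c (L 1) = eval_multilin n m c b'" by (rule eval_multilin_cong)
  have "\<exists>t. \<forall>x\<in>insert s S. eval_multilin n m c (L t) $$ x \<noteq> 0"
  proof (rule polynomial_funs_common_nonzero[OF inf])
    show "finite (insert s S)" using insert by simp
    fix x assume x: "x \<in> insert s S"
    obtain i j where ij: "x = (i, j)" "i < n" "j < n" using insert.prems(1) x by (cases x) auto
    have "L t k $$ (p, q) = (1 - t) * b k $$ (p, q) + t * b' k $$ (p, q)" if "p < n" "q < n" for p q t k
      using that by (simp add: L_def)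
    then show "polynomial_fun (\<lambda>t. eval_multilin n m c (L t) $$ x)"
      unfolding ij(1) using ij homogeneous_mat_carrier[OF homL]
      by (intro polynomial_fun_eval_multilin) (auto simp: polynomial_fun_interpolation)
    \<comment> \<open>The parameter 0 serves the old positions and 1 the new one.\<close>
    show "\<exists>t. eval_multilin n m c (L t) $$ x \<noteq> 0"
      using x L0 L1 b(2) b'(2) by (metis insertE)
  qed
  then show ?case using homL by blast
qed

section \<open>A cyclic value with all cyclic entries nonzero\<close>

lemma cyclic_mat_in_image_multilin:
  fixes c :: "(nat \<Rightarrow> nat) \<Rightarrow> 'a::field"
  assumes inf: "infinite (UNIV :: 'a set)" and n: "n \<ge> 2"
    and nPI: "\<not> is_PI n m c" and ncen: "\<not> is_central n m c"
  shows "\<exists>cs. (\<forall>i<n. cs i \<noteq> 0) \<and> cyclic_mat n cs \<in> image_multilin n m c"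
proof -
  \<comment> \<open>Not being a polynomial identity, \<open>p\<close> can fail to be central only
    through a non-scalar value.\<close>
  obtain A where "A \<in> image_multilin n m c" "\<not> (\<exists>k. A = k \<cdot>\<^sub>m 1\<^sub>m n)"
    using nPI ncen unfolding is_central_def by auto
  then obtain B where "B \<in> image_multilin n m c" "B $$ (0, 1) \<noteq> 0"
    using image_multilin_nonscalar_entry[OF n] by blast
  then obtain a where a: "\<And>k. k < m \<Longrightarrow> a k \<in> carrier_mat n n" "eval_multilin n m c a $$ (0, 1) \<noteq> 0"
    by (auto simp: image_multilin_def)
  obtain b g where b: "\<And>k. k < m \<Longrightarrow> homogeneous_mat n (g k) (b k)"
    "eval_multilin n m c b $$ (0, 1) \<noteq> 0"
    using eval_multilin_homogeneous_arguments[of m a n 0 1 c] a n by auto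
  \<comment> \<open>The value is homogeneous of the total degree, and its nonzero entry sits at
    (0,1), a position of degree 1. From here on the degrees \<open>g\<close> stay fixed.\<close>
  have deg: "(\<Sum>k<m. g k) mod n = 1"
    using homogeneous_matD[OF homogeneous_eval_multilin[of m n g b c, OF b(1)] _ _ b(2)] n by simp
  have shifted: "\<exists>b'. (\<forall>k<m. homogeneous_mat n (g k) (b' k)) \<and>
      eval_multilin n m c b' $$ (s, (s + 1) mod n) \<noteq> 0" if s: "s < n" for s
  proof -
    \<comment> \<open>This is the shift i - s modulo n, with \<open>n - s\<close> avoiding truncated
      subtraction. It carries position (s, s+1) to (0,1), indices being read modulo n.\<close>
    define \<pi> where "\<pi> i = (i + (n - s)) mod n" for i
    have \<pi>n: "\<pi> i < n" for i using n by (simp add: \<pi>_def)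
    have \<pi>inv: "(\<pi> i + s) mod n = i" if "i < n" for i
    proof -
      have "(\<pi> i + s) mod n = (i + (n - s) + s) mod n" by (simp add: \<pi>_def mod_add_left_eq)
      then show ?thesis using s that by simp
    qed
    have inj: "inj_on \<pi> {..<n}" by (metis \<pi>inv inj_onI lessThan_iff)
    obtain P Q :: "'a mat" where PQ: "P \<in> carrier_mat n n" "Q \<in> carrier_mat n n"
      "P * Q = 1\<^sub>m n" "Q * P = 1\<^sub>m n"
      and conj: "\<And>A i j. A \<in> carrier_mat n n \<Longrightarrow> i < n \<Longrightarrow> j < n \<Longrightarrow> (P * A * Q) $$ (i, j) = A $$ (\<pi> i, \<pi> j)"
      using permutation_conjugator[OF inj] \<pi>n by blast
    \<comment> \<open>A cyclic shift preserves differences of indices and hence degrees; adding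
      \<open>s\<close> back recovers the original indices.\<close>
    have "homogeneous_mat n (g k) (P * b k * Q)" if "k < m" for k
      unfolding homogeneous_mat_def
    proof (intro conjI allI impI)
      have carb: "b k \<in> carrier_mat n n" using b(1)[OF that] by (rule homogeneous_mat_carrier)
      then show "P * b k * Q \<in> carrier_mat n n" using PQ by simp
      fix i j assume ij: "i < n" "j < n" "(P * b k * Q) $$ (i, j) \<noteq> 0"
      then have "\<pi> j = (\<pi> i + g k) mod n"
        using conj[OF carb] b(1)[OF that] \<pi>n by (auto simp: homogeneous_mat_def)
      then have "(\<pi> j + s) mod n = ((\<pi> i + s) mod n + g k) mod n"
        by (simp add: mod_simps add_ac)
      then show "j = (i + g k) mod n" using \<pi>inv ij by simp
    qed
    moreover have "eval_multilin n m c (\<lambda>k. P * b k * Q) $$ (s, (s + 1) mod n) \<noteq> 0"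
    proof -
      have "\<pi> s = 0" using s by (simp add: \<pi>_def)
      moreover have "\<pi> ((s + 1) mod n) = (n + 1) mod n"
        using s unfolding \<pi>_def mod_add_left_eq by simp
      then have "\<pi> ((s + 1) mod n) = 1" using n by (simp add: mod_Suc)
      ultimately show ?thesis
        using eval_multilin_conj[OF PQ homogeneous_mat_carrier[OF b(1)]] conj[of _ s "(s + 1) mod n"] s n b(2)
        by simp
    qed
    ultimately show ?thesis by (intro exI[of _ "\<lambda>k. P * b k * Q"]) simp
  qed
  define S where "S = (\<lambda>s. (s, (s + 1) mod n)) ` {..<n}"
  have "\<exists>b'. (\<forall>k<m. homogeneous_mat n (g k) (b' k)) \<and> (\<forall>s\<in>S. eval_multilin n m c b' $$ s \<noteq> 0)"
    using shifted n by (intro eval_multilin_common_nonzero[OF inf]) (auto simp: S_def)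
  then obtain b' where b': "\<And>k. k < m \<Longrightarrow> homogeneous_mat n (g k) (b' k)"
    "\<And>s. s < n \<Longrightarrow> eval_multilin n m c b' $$ (s, (s + 1) mod n) \<noteq> 0"
    by (auto simp: S_def)
  define cs where "cs s = eval_multilin n m c b' $$ (s, (s + 1) mod n)" for s
  \<comment> \<open>Total degree 1 forces every entry outside the cyclic positions to vanish, so the
    value has the required shape.\<close>
  have zero: "eval_multilin n m c b' $$ (i, j) = 0" if "i < n" "j < n" "j \<noteq> (i + 1) mod n" for i j
  proof -
    have "(i + (\<Sum>k<m. g k)) mod n = (i + 1) mod n" by (metis deg mod_add_right_eq)
    then show ?thesis
      using homogeneous_eval_multilin[of m n g b' c] b'(1) that by (auto simp: homogeneous_mat_def)
  qed
  have "cyclic_mat n cs = eval_multilin n m c b'"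
  proof (rule eq_matI)
    fix i j assume "i < dim_row (eval_multilin n m c b')" "j < dim_col (eval_multilin n m c b')"
    then have ij: "i < n" "j < n" by (auto simp: eval_multilin_def)
    have "(i + 1) mod n = (if i = n - 1 then 0 else i + 1)" using ij by auto
    then show "cyclic_mat n cs $$ (i, j) = eval_multilin n m c b' $$ (i, j)"
      using ij zero[OF ij] by (auto simp: cyclic_mat_def cs_def split: if_splits)
  qed (auto simp: cyclic_mat_def eval_multilin_def)
  moreover have "eval_multilin n m c b' \<in> image_multilin n m c"
    using b'(1) by (intro image_multilinI) (rule homogeneous_mat_carrier)
  ultimately show ?thesis using b'(2) by (intro exI[of _ cs]) (auto simp: cs_def)
qed

subsection \<open>Eigenvalues of cyclic matrices\<close>

text \<open>Laplace expansion along column 0 meets only X in row 0 and the negated corner entry in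
  row r = n - 1. The two minors are triangular: one has X on its diagonal, the other the negated
  superdiagonal entries.\<close>

lemma char_poly_cyclic_mat:
  fixes cs :: "nat \<Rightarrow> 'a::comm_ring_1"
  assumes n: "n \<ge> 2"
  shows "char_poly (cyclic_mat n cs) = Polynomial.monom 1 n - [:\<Prod>i<n. cs i:]"
proof -
  obtain r where r: "n = Suc r" "r \<ge> 1" using n by (cases n) auto
  define M where "M = char_poly_matrix (cyclic_mat n cs)"
  have M: "M \<in> carrier_mat n n" by (simp add: M_def cyclic_mat_def)
  have Mij: "M $$ (i, j) = (if i = j then [:0, 1:] else if j = i + 1 then [:- cs i:]
      else if i = r \<and> j = 0 then [:- cs r:] else 0)" if "i < n" "j < n" for i j
    using that r by (auto simp: M_def char_poly_matrix_def cyclic_mat_def)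
  have "det (mat_delete M 0 0) = prod_list (diag_mat (mat_delete M 0 0))"
  proof (rule det_upper_triangular)
    show "mat_delete M 0 0 \<in> carrier_mat r r" using M r by (auto simp: mat_delete_def)
    show "upper_triangular (mat_delete M 0 0)"
      using M r by (auto simp: mat_delete_def Mij)
  qed
  also have "diag_mat (mat_delete M 0 0) = map (\<lambda>_. [:0, 1:]) [0..<r]"
    using M r by (auto simp: diag_mat_def mat_delete_def Mij)
  also have "prod_list \<dots> = [:0, 1:] ^ r" by (simp add: map_replicate_const)
  finally have d0: "det (mat_delete M 0 0) = [:0, 1:] ^ r" .
  have "det (mat_delete M r 0) = prod_list (diag_mat (mat_delete M r 0))"
  proof (rule det_lower_triangular)
    show "mat_delete M r 0 \<in> carrier_mat r r" using M r by (auto simp: mat_delete_def)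
    show "mat_delete M r 0 $$ (i, j) = 0" if "i < j" "j < r" for i j
      using M r that by (auto simp: mat_delete_def Mij)
  qed
  also have "diag_mat (mat_delete M r 0) = map (\<lambda>i. [:- cs i:]) [0..<r]"
    using M r by (auto simp: diag_mat_def mat_delete_def Mij)
  also have "prod_list \<dots> = (\<Prod>i<r. [:- cs i:])"
    by (simp add: prod.distinct_set_conv_list[symmetric] atLeast0LessThan)
  also have "\<dots> = [:(- 1) ^ r * (\<Prod>i<r. cs i):]"
    by (induction r) (auto simp: algebra_simps)
  finally have dr: "det (mat_delete M r 0) = [:(- 1) ^ r * (\<Prod>i<r. cs i):]" .
  have "char_poly (cyclic_mat n cs) = det M" by (simp add: char_poly_def M_def)
  also have "\<dots> = (\<Sum>i<n. M $$ (i, 0) * cofactor M i 0)"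
    using M n by (intro laplace_expansion_column) auto
  also have "\<dots> = (\<Sum>i\<in>{0, r}. M $$ (i, 0) * cofactor M i 0)"
    using r by (intro sum.mono_neutral_right) (auto simp: Mij)
  also have "\<dots> = [:0, 1:] * [:0, 1:] ^ r + [:- cs r:] * ((- 1) ^ r * [:(- 1) ^ r * (\<Prod>i<r. cs i):])"
    using r by (simp add: Mij cofactor_def d0 dr)
  \<comment> \<open>The cofactor sign and the sign from the r negated diagonal entries are both
    (-1)^r and cancel.\<close>
  also have "[:- cs r:] * ((- 1) ^ r * [:(- 1) ^ r * (\<Prod>i<r. cs i):]) = - [:\<Prod>i<n. cs i:]"
  proof -
    have "(- 1 :: 'a poly) ^ r * [:(- 1) ^ r * x:] = [:x:]" for x
      by (cases "even r") auto
    then show ?thesis by (simp add: r mult.commute)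
  qed
  also have "[:0, 1:] * [:0, 1:] ^ r = (Polynomial.monom 1 n :: 'a poly)"
    by (simp add: r monom_altdef)
  finally show ?thesis by simp
qed

section \<open>Primitive roots of unity and the factorization of X^n - c^n\<close>

lemma primitive_root_iff_dvd:
  fixes \<epsilon> :: "'a::comm_ring_1"
  assumes "n > 0"
  shows "primitive_root n \<epsilon> \<longleftrightarrow> (\<forall>k. \<epsilon> ^ k = 1 \<longleftrightarrow> n dvd k)"
proof
  assume prim: "primitive_root n \<epsilon>"
  show "\<forall>k. \<epsilon> ^ k = 1 \<longleftrightarrow> n dvd k"
  proof
    fix k
    have "\<epsilon> ^ k = (\<epsilon> ^ n) ^ (k div n) * \<epsilon> ^ (k mod n)"
      by (simp flip: power_mult power_add)
    then have "\<epsilon> ^ k = \<epsilon> ^ (k mod n)" using prim by (simp add: primitive_root_def)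
    moreover have "\<epsilon> ^ (k mod n) = 1 \<longleftrightarrow> k mod n = 0"
      using prim assms by (cases "k mod n = 0") (auto simp: primitive_root_def)
    ultimately show "\<epsilon> ^ k = 1 \<longleftrightarrow> n dvd k" by (simp add: dvd_eq_mod_eq_0)
  qed
next
  assume "\<forall>k. \<epsilon> ^ k = 1 \<longleftrightarrow> n dvd k"
  then show "primitive_root n \<epsilon>" by (auto simp: primitive_root_def dest: nat_dvd_not_less)
qed

text \<open>A root of 1 + X + ... + X^(q-1) has q-th power 1, and it differs from 1 because that sum
  at 1 is q, which is nonzero in the field.\<close>

lemma ex_primitive_root_prime:
  fixes q :: nat
  assumes q: "Factorial_Ring.prime q" and nz: "(of_nat q :: 'a::alg_closed_field) \<noteq> 0"
  shows "\<exists>\<omega>::'a. \<forall>k. \<omega> ^ k = 1 \<longleftrightarrow> q dvd k"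
proof -
  have "q - 1 > 0" using prime_gt_1_nat[OF q] by simp
  then obtain \<omega> :: 'a where "(\<Sum>k\<le>q - 1. 1 * \<omega> ^ k) = 0"
    using alg_closed[of "q - 1" "\<lambda>_. 1 :: 'a"] by auto
  moreover have "{..q - 1} = {..<q}" using prime_gt_0_nat[OF q] by auto
  ultimately have sum: "(\<Sum>k<q. \<omega> ^ k) = 0" by simp
  have pow: "\<omega> ^ q = 1"
    using power_diff_1_eq[of \<omega> q] sum by simp
  have "\<omega> \<noteq> 1" using sum nz by auto
  have "q dvd k" if "\<omega> ^ k = 1" for k
  proof (rule ccontr)
    assume "\<not> q dvd k"
    then have "coprime k q" using q by (metis coprime_commute prime_imp_coprime)
    \<comment> \<open>Inverting \<open>k\<close> modulo \<open>q\<close> recovers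
      \<open>\<omega>\<close> itself as a power of \<open>\<omega> ^ k\<close>, which would force it
      to be 1.\<close>
    then obtain x where "[k * x = 1] (mod q)" using cong_solve_coprime_nat by auto
    then have "(k * x) mod q = 1" using prime_gt_1_nat[OF q] by (simp add: cong_def)
    then have "k * x = q * (k * x div q) + 1" by (metis mult_div_mod_eq)
    then have "\<omega> ^ (k * x) = \<omega>" by (metis mult.left_neutral pow power_add power_mult power_one power_one_right)
    with that \<open>\<omega> \<noteq> 1\<close> show False by (simp add: power_mult)
  qed
  moreover have "\<omega> ^ k = 1" if "q dvd k" for k
    using that pow by (auto simp: power_mult elim!: dvdE)
  ultimately show ?thesis by blast
qed

text \<open>Induction on the prime factors of n. For a new prime q, an element of order n is
  replaced by one of its q-th roots if q divides n, and otherwise multiplied by an element of order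
  q.\<close>

lemma ex_primitive_root:
  assumes "n > 0" "(of_nat n :: 'a::alg_closed_field) \<noteq> 0"
  shows "\<exists>\<epsilon>::'a. \<forall>k. \<epsilon> ^ k = 1 \<longleftrightarrow> n dvd k"
  using assms
proof (induction n rule: prime_divisors_induct)
  case zero
  then show ?case by simp
next
  case (unit n)
  then show ?case by (intro exI[of _ 1]) auto
next
  case (factor q n)
  then have q: "Factorial_Ring.prime q" and n: "n > 0" and nz: "(of_nat q :: 'a) \<noteq> 0" "(of_nat n :: 'a) \<noteq> 0" by auto
  obtain \<epsilon> :: 'a where \<epsilon>: "\<And>k. \<epsilon> ^ k = 1 \<longleftrightarrow> n dvd k" using factor.IH n nz by blast
  show ?case
  proof (cases "q dvd n")
    case True
    obtain z where z: "z ^ q = \<epsilon>" using nth_root_exists[of q \<epsilon>] prime_gt_0_nat[OF q] by auto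
    have "q * n dvd k" if "z ^ k = 1" for k
    proof -
      \<comment> \<open>This gives n dvd k, hence q dvd k; after cancelling q the order of
        \<open>\<epsilon>\<close> applies to the quotient \<open>l\<close>.\<close>
      have "\<epsilon> ^ k = 1" using that z by (metis mult.commute power_mult power_one)
      then have "q dvd k" using \<epsilon> True dvd_trans by blast
      then obtain l where l: "k = q * l" by (elim dvdE)
      then have "\<epsilon> ^ l = 1" using that z by (simp add: power_mult)
      then show ?thesis using \<epsilon> l by simp
    qed
    moreover have "z ^ k = 1" if "q * n dvd k" for k
    proof -
      from that obtain l where "k = q * n * l" by (rule dvdE)
      then have "k = q * (n * l)" by (simp only: mult.assoc)
      then have "z ^ k = \<epsilon> ^ (n * l)" using z by (simp only: power_mult[of z q])
      then show ?thesis using \<epsilon>[of "n * l"] by simp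
    qed
    ultimately show ?thesis by blast
  next
    case False
    then have cop: "coprime q n" using q by (rule_tac prime_imp_coprime)
    obtain \<omega> :: 'a where \<omega>: "\<And>k. \<omega> ^ k = 1 \<longleftrightarrow> q dvd k"
      using ex_primitive_root_prime[OF q nz(1)] by blast
    have "q * n dvd k" if "(\<epsilon> * \<omega>) ^ k = 1" for k
    proof -
      have "\<epsilon> ^ (k * l) * \<omega> ^ (k * l) = 1" for l
        using that by (metis power_mult power_mult_distrib power_one)
      \<comment> \<open>The q-th power removes \<open>\<omega>\<close> and the n-th power removes
        \<open>\<epsilon>\<close>; coprimality then strips the extra factors from the
        exponents.\<close>
      from this[of q] this[of n] have "\<epsilon> ^ (k * q) = 1" "\<omega> ^ (k * n) = 1"
        using \<omega>[of "k * q"] \<epsilon>[of "k * n"] by auto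
      then have "n dvd k" "q dvd k"
        using cop by (auto simp: \<epsilon> \<omega> coprime_dvd_mult_left_iff coprime_commute)
      then show ?thesis using cop by (rule_tac divides_mult)
    qed
    moreover have "(\<epsilon> * \<omega>) ^ k = 1" if "q * n dvd k" for k
      using that \<epsilon> \<omega> by (metis dvd_mult_left dvd_mult_right mult_1 power_mult_distrib)
    ultimately show ?thesis by blast
  qed
qed

lemma monom_minus_power_factorization:
  fixes \<gamma> \<epsilon> :: "'a::field"
  assumes n: "n > 0" and \<gamma>: "\<gamma> \<noteq> 0" and prim: "primitive_root n \<epsilon>"
  shows "Polynomial.monom 1 n - [:\<gamma> ^ n:] = (\<Prod>i<n. [:- (\<gamma> * \<epsilon> ^ i), 1:])"
\<comment> \<open>Both sides have degree at most n and coefficient 1 at n, so their difference has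
  degree below n. It vanishes at the n distinct points
  \<open>\<gamma> * \<epsilon> ^ i\<close>.\<close>
proof (rule poly_eqI_degree_lead_coeff[where A = "(\<lambda>i. \<gamma> * \<epsilon> ^ i) ` {..<n}" and n = n])
  have pow: "\<epsilon> ^ k = 1 \<longleftrightarrow> n dvd k" for k using prim primitive_root_iff_dvd[OF n] by blast
  have \<epsilon>: "\<epsilon> \<noteq> 0" using prim n by (auto simp: primitive_root_def power_0_left)
  have less: "\<epsilon> ^ i \<noteq> \<epsilon> ^ j" if "i < j" "j < n" for i j
  proof
    assume "\<epsilon> ^ i = \<epsilon> ^ j"
    moreover have "\<epsilon> ^ j = \<epsilon> ^ i * \<epsilon> ^ (j - i)" using that by (simp flip: power_add)
    ultimately have "\<epsilon> ^ (j - i) = 1" using \<epsilon> by simp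
    with pow have "n dvd j - i" by blast
    with that show False using nat_dvd_not_less[of "j - i" n] by simp
  qed
  have "inj_on (\<lambda>i. \<gamma> * \<epsilon> ^ i) {..<n}"
  proof (rule inj_onI)
    fix i j assume "i \<in> {..<n}" "j \<in> {..<n}" "\<gamma> * \<epsilon> ^ i = \<gamma> * \<epsilon> ^ j"
    then show "i = j" using less[of i j] less[of j i] \<gamma> by (cases i j rule: linorder_cases) auto
  qed
  then show "n \<le> card ((\<lambda>i. \<gamma> * \<epsilon> ^ i) ` {..<n})" by (simp add: card_image)
  have deg: "Polynomial.degree (\<Prod>i<n. [:- (\<gamma> * \<epsilon> ^ i), 1:]) = n"
    by (subst degree_prod_eq_sum_degree) auto
  then show "Polynomial.degree (\<Prod>i<n. [:- (\<gamma> * \<epsilon> ^ i), 1:]) \<le> n" by simp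
  show "Polynomial.degree (Polynomial.monom 1 n - [:\<gamma> ^ n:]) \<le> n"
    by (rule degree_diff_le) (auto simp: degree_monom_le)
  have "Polynomial.lead_coeff (\<Prod>i<n. [:- (\<gamma> * \<epsilon> ^ i), 1:]) = 1" by (simp add: lead_coeff_prod)
  then show "Polynomial.coeff (Polynomial.monom 1 n - [:\<gamma> ^ n:]) n = Polynomial.coeff (\<Prod>i<n. [:- (\<gamma> * \<epsilon> ^ i), 1:]) n"
    using n by (simp add: deg coeff_pCons split: nat.splits)
  show "poly (Polynomial.monom 1 n - [:\<gamma> ^ n:]) x = poly (\<Prod>i<n. [:- (\<gamma> * \<epsilon> ^ i), 1:]) x"
    if "x \<in> (\<lambda>i. \<gamma> * \<epsilon> ^ i) ` {..<n}" for x
  proof -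
    from that obtain i where i: "i < n" "x = \<gamma> * \<epsilon> ^ i" by auto
    have "(\<epsilon> ^ i) ^ n = 1" using pow[of "i * n"] by (simp add: power_mult)
    then have "poly (Polynomial.monom 1 n - [:\<gamma> ^ n:]) x = 0"
      by (simp add: i poly_monom power_mult_distrib)
    moreover have "poly (\<Prod>i<n. [:- (\<gamma> * \<epsilon> ^ i), 1:]) x = 0"
      using i by (auto simp: poly_prod)
    ultimately show ?thesis by simp
  qed
qed

text \<open>The eigenvalues are stated, with multiplicity, as the linear factors of the
  characteristic polynomial over \<open>alg_closure\<close>.\<close>

theorem theorem1p11:
  fixes n m :: nat and c :: "(nat \<Rightarrow> nat) \<Rightarrow> 'a::field"
  assumes "infinite (UNIV :: 'a set)"
    and "n \<ge> 2"
    and "\<not> is_PI n m c"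
    and "\<not> is_central n m c"
  shows "(\<exists>cs. (\<forall>i<n. cs i \<noteq> 0) \<and> cyclic_mat n cs \<in> image_multilin n m c)
     \<and> ((CHAR('a) = 0 \<or> coprime (CHAR('a)) n) \<longrightarrow>
         (\<exists>A \<in> image_multilin n m c. \<exists>\<gamma> :: 'a alg_closure. \<exists>\<epsilon>.
            \<gamma> \<noteq> 0 \<and> primitive_root n \<epsilon> \<and>
            char_poly (map_mat to_ac A) = (\<Prod>i<n. [:- (\<gamma> * \<epsilon> ^ i), 1:])))"
proof -
  obtain cs where cs: "\<forall>i<n. cs i \<noteq> 0" "cyclic_mat n cs \<in> image_multilin n m c"
    using cyclic_mat_in_image_multilin[OF assms] by blast
  have n: "n > 0" using assms(2) by simp
  have "\<exists>\<gamma> \<epsilon> :: 'a alg_closure. \<gamma> \<noteq> 0 \<and> primitive_root n \<epsilon> \<and>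
      char_poly (map_mat to_ac (cyclic_mat n cs)) = (\<Prod>i<n. [:- (\<gamma> * \<epsilon> ^ i), 1:])"
    if "CHAR('a) = 0 \<or> coprime (CHAR('a)) n"
  proof -
    \<comment> \<open>Characteristic 0 divides only 0, and a characteristic that is coprime to n yet
      divides it would be 1. Hence n is nonzero in the closure and a primitive root exists.\<close>
    have "\<not> CHAR('a) dvd n"
    proof
      assume "CHAR('a) dvd n"
      with that n have "CHAR('a) = 1" by (auto simp: coprime_absorb_left)
      then show False by simp
    qed
    then have "(of_nat n :: 'a alg_closure) \<noteq> 0" by (simp add: of_nat_eq_0_iff_char_dvd)
    then obtain \<epsilon> :: "'a alg_closure" where \<epsilon>: "primitive_root n \<epsilon>"
      using ex_primitive_root[OF n] primitive_root_iff_dvd[OF n] by blast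
    \<comment> \<open>An n-th root of the product of the cyclic entries turns the characteristic
      polynomial into X^n - \<open>\<gamma> ^ n\<close>; it is nonzero since all the entries
      are.\<close>
    obtain \<gamma> :: "'a alg_closure" where \<gamma>: "\<gamma> ^ n = (\<Prod>i<n. to_ac (cs i))"
      using nth_root_exists[OF n] by blast
    have "(\<Prod>i<n. to_ac (cs i)) \<noteq> 0" using cs(1) by simp
    then have \<gamma>0: "\<gamma> \<noteq> 0" using \<gamma> n by (auto simp: power_0_left)
    have "map_mat to_ac (cyclic_mat n cs) = cyclic_mat n (\<lambda>i. to_ac (cs i))"
      by (rule eq_matI) (auto simp: cyclic_mat_def)
    then have "char_poly (map_mat to_ac (cyclic_mat n cs)) = Polynomial.monom 1 n - [:\<gamma> ^ n:]"
      using char_poly_cyclic_mat[OF assms(2)] \<gamma> by simp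
    then show ?thesis using \<gamma>0 \<epsilon> monom_minus_power_factorization[OF n \<gamma>0 \<epsilon>] by auto
  qed
  then show ?thesis using cs by blast
qed

end
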